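(* Let $n\in\mathbb N$. For every $C\in\operatorname{NC}(\mathbb R^n)$ there exists an open set $P\in\operatorname{NC}(\mathbb R^n)^+$ such that $C\subseteq P$, and for every finite coloring of $\mathbb Q^n_+\setminus P$ there exists an infinite family $\mathcal A$ of sequences in $\mathbb Q^n_+\setminus P$ which satisfies the following conditions: (i) $\operatorname{FS}(A)$ is a closed discrete subset of $\mathbb R^n$ for all $A\in\mathcal A$; (ii) the set $\bigcup_{A\in\mathcal A}\operatorname{FS}(A)$ is monochromatic (in particular it is contained in $\mathbb Q^n_+\setminus P$); (iii) $\operatorname{FS}(A)\cap\operatorname{FS}(B)=\emptyset$ for all distinct $A,B\in\mathcal A$; (iv) the set $\bigcup_{A\in\mathcal A}\operatorname{FS}(A)$ is dense in an open unbounded subset of $\mathbb R^n$.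
   Context: $\mathbb N$ is the set of positive integers. $\mathbb R^n$ is the additive group with Euclidean topology, and $\mathbb Q^n_+=\{(x_1,\dots,x_n)\in\mathbb Q^n: x_i>0\text{ for all }i\le n\}$. Sequences are injective, indexed by $\mathbb N$, and identified with their images. For a sequence $A=\{a(k):k\in\mathbb N\}$ in $\mathbb R^n$, $\operatorname{FS}(A)$ is the set of all sums $a(k_1)+\dots+a(k_j)$ with $j\ge1$ and $k_1<\dots<k_j$. A finite coloring of a set is a map from it to a finite set; a subset is monochromatic if the coloring is defined and constant on it. $\operatorname{NC}(\mathbb R^n)$ is the ideal of all subsets of $\mathbb R^n$ contained in the union of a compact set and a nowhere dense set; $\operatorname{NC}(\mathbb R^n)^+=\mathcal P(\mathbb R^n)\setminus\operatorname{NC}(\mathbb R^n)$. A set $E$ is dense in an open set $Q$ if $E\cap Q$ is dense in $Q$. *)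

theory Defs
  imports "HOL-Analysis.Analysis"
begin

definition nowhere_dense :: "'a::topological_space set \<Rightarrow> bool" where
  "nowhere_dense S \<longleftrightarrow> interior (closure S) = {}"

definition NC :: "'a::topological_space set set" where
  "NC = {S. \<exists>K N. compact K \<and> nowhere_dense N \<and> S \<subseteq> K \<union> N}"

definition pos_rat_vectors :: "(real ^ 'n) set" where
  "pos_rat_vectors = {x. \<forall>i. x $ i \<in> \<rat> \<and> 0 < x $ i}"

text \<open>Choosing indices \<open>k\<^sub>1 < \<dots> < k\<^sub>j\<close> with \<open>j \<ge> 1\<close> amounts to choosing a nonempty finite
  index set. Sequences are indexed from 0 rather than from 1.\<close>
definition FS :: "(nat \<Rightarrow> 'a::comm_monoid_add) \<Rightarrow> 'a set" where
  "FS a = {\<Sum>k\<in>F. a k | F. finite F \<and> F \<noteq> {}}"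

text \<open>Colorings are total functions here; only their values on the domain \<open>D\<close> matter. Natural
  numbers suffice as colors, since any finite set of colors embeds into them.\<close>
definition finite_coloring :: "'a set \<Rightarrow> ('a \<Rightarrow> nat) \<Rightarrow> bool" where
  "finite_coloring D col \<longleftrightarrow> finite (col ` D)"

definition monochromatic :: "'a set \<Rightarrow> ('a \<Rightarrow> nat) \<Rightarrow> 'a set \<Rightarrow> bool" where
  "monochromatic D col M \<longleftrightarrow> M \<subseteq> D \<and> (\<exists>c. \<forall>x\<in>M. col x = c)"

definition dense_in :: "'a::topological_space set \<Rightarrow> 'a set \<Rightarrow> bool" where
  "dense_in E Q \<longleftrightarrow> Q \<subseteq> closure (E \<inter> Q)"

end

theory Submission
  imports Defs
begin

text \<open>Write \<open>C \<subseteq> K \<union> N\<close> with \<open>K\<close> compact and \<open>N\<close> nowhere dense, and exhaust the positive rational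
  vectors by finite sets \<open>W k\<close> with \<open>W k + W k \<subseteq> W (k + 1)\<close>. Inductively there are balls \<open>B k\<close>, going
  to infinity in every coordinate, such that all translates \<open>w + B k\<close> with \<open>w \<in> W k\<close> avoid \<open>K \<union> N\<close>;
  \<open>P\<close> is the complement of the union of the closed translates. Sums \<open>b\<^sub>1 + \<dots> + b\<^sub>j\<close> of rational
  points of the balls \<open>B k\<^sub>1, \<dots>, B k\<^sub>j\<close>, where \<open>k\<^bsub>i+1\<^esub>\<close> is large in terms of \<open>b\<^sub>i\<close>, lie outside \<open>P\<close>,
  and their tails together with the complements of the sets in \<open>NC\<close> generate a filter that contains
  its own sum. Hence there is such an ultrafilter \<open>F\<close> all of whose members are outside \<open>NC\<close>, that is, dense in an
  unbounded open set. Let \<open>E\<close> be the color class in \<open>F\<close>. The points \<open>x \<in> E\<close> with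
  \<open>{y. x + y \<in> E} \<in> F\<close> form a member of \<open>F\<close>, and from each of them the Galvin-Glazer
  construction starts an \<open>FS\<close>-set in \<open>E\<close>; countably many such constructions are interleaved.\<close>

subsection \<open>Ultrafilters that contain their own sum\<close>

text \<open>Zorn's lemma used downwards. A predicate holds eventually for the infimum of a nonempty
  chain exactly if it does for some member, so \<open>Q\<close> only has to survive infima of this
  kind.\<close>

lemma minimal_filter_exists:
  fixes F0 :: "'a filter"
  assumes F0: "Q F0"
    and Inf: "\<And>B. B \<noteq> {} \<Longrightarrow> (\<And>F. F \<in> B \<Longrightarrow> Q F) \<Longrightarrow>
      (\<And>P. eventually P (Inf B) \<longleftrightarrow> (\<exists>F\<in>B. eventually P F)) \<Longrightarrow> Q (Inf B)"
  obtains M where "Q M" "M \<le> F0" "\<And>G. Q G \<Longrightarrow> G \<le> M \<Longrightarrow> G = M"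
proof -
  let ?S = "{F. Q F \<and> F \<le> F0}"
  let ?R = "\<lambda>F G :: 'a filter. G \<le> F"
  have "\<exists>M\<in>?S. \<forall>G\<in>?S. ?R M G \<longrightarrow> G = M"
  proof (rule predicate_Zorn)
    show "partial_order_on ?S (relation_of ?R ?S)"
      by (rule partial_order_on_relation_ofI) auto
  next
    fix B assume B: "B \<in> Chains (relation_of ?R ?S)"
    show "\<exists>u\<in>?S. \<forall>a\<in>B. ?R a u"
    proof (cases "B = {}")
      case True
      then show ?thesis using F0 by auto
    next
      case False
      have sub: "B \<subseteq> ?S"
        using B by (auto simp: Chains_def relation_of_def)
      have lin: "F \<le> G \<or> G \<le> F" if "F \<in> B" "G \<in> B" for F G
        using B that by (auto simp: Chains_def relation_of_def)
      have "eventually P (Inf B) \<longleftrightarrow> (\<exists>F\<in>B. eventually P F)" for P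
        by (rule eventually_Inf_base[OF False]) (metis inf.absorb1 inf.absorb2 lin order_refl)
      then have "Q (Inf B)"
        using sub by (intro Inf[OF False]) auto
      moreover have "Inf B \<le> F0"
      proof -
        obtain F where "F \<in> B" using False by blast
        then show ?thesis using sub by (intro Inf_lower2[of F]) auto
      qed
      ultimately show ?thesis
        by (auto intro: Inf_lower)
    qed
  qed
  then obtain M where "Q M" "M \<le> F0" and "\<And>G. Q G \<Longrightarrow> G \<le> F0 \<Longrightarrow> G \<le> M \<Longrightarrow> G = M"
    by auto
  then show thesis
    by (metis order_trans that)
qed

definition ultra :: "'a filter \<Rightarrow> bool" where
  "ultra F \<longleftrightarrow> F \<noteq> bot \<and> (\<forall>P. eventually P F \<or> eventually (\<lambda>x. \<not> P x) F)"

text \<open>A minimal proper filter is an ultrafilter: if \<open>\<not> P\<close> does not hold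
  eventually, restricting to \<open>P\<close> keeps the filter proper, so by minimality the
  restriction changes nothing.\<close>

lemma ultra_below:
  assumes "F \<noteq> bot"
  obtains q where "ultra q" "q \<le> F"
proof -
  obtain q where q: "q \<noteq> bot" "q \<le> F" and min: "\<And>G. G \<noteq> bot \<Longrightarrow> G \<le> q \<Longrightarrow> G = q"
    by (rule minimal_filter_exists[of "\<lambda>F. F \<noteq> bot" F])
       (use assms in \<open>auto simp: trivial_limit_def\<close>)
  have "eventually P q" if "\<not> eventually (\<lambda>x. \<not> P x) q" for P
  proof -
    have "inf q (principal {x. P x}) \<noteq> bot"
      using that by (simp add: trivial_limit_def eventually_inf_principal)
    then have "inf q (principal {x. P x}) = q"
      by (rule min) simp
    moreover have "eventually P (inf q (principal {x. P x}))"
      by (simp add: eventually_inf_principal)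
    ultimately show ?thesis by simp
  qed
  with q that show thesis
    by (auto simp: ultra_def)
qed

lemma ultra_finite_range:
  assumes "ultra F" "finite A" "eventually (\<lambda>x. f x \<in> A) F"
  obtains c where "eventually (\<lambda>x. f x = c) F"
proof -
  have "\<exists>c. eventually (\<lambda>x. f x = c) F"
  proof (rule ccontr)
    assume "\<nexists>c. eventually (\<lambda>x. f x = c) F"
    then have "eventually (\<lambda>x. \<forall>c\<in>A. f x \<noteq> c) F"
      using assms by (intro eventually_ball_finite) (auto simp: ultra_def)
    then have "eventually (\<lambda>_. False) F"
      using assms(3) by eventually_elim auto
    then show False
      using assms(1) by (simp add: ultra_def)
  qed
  then show thesis using that by blast
qed

text \<open>On ultrafilters this is the addition of the Stone-Cech compactification. The order
  matters: the quantifier over the left summand stands outside.\<close>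

definition filter_add :: "'a::plus filter \<Rightarrow> 'a filter \<Rightarrow> 'a filter" where
  "filter_add F G = Abs_filter (\<lambda>P. \<forall>\<^sub>F x in F. \<forall>\<^sub>F y in G. P (x + y))"

lemma eventually_filter_add:
  "eventually P (filter_add F G) \<longleftrightarrow> (\<forall>\<^sub>F x in F. \<forall>\<^sub>F y in G. P (x + y))"
  unfolding filter_add_def
proof (rule eventually_Abs_filter, rule is_filter.intro)
  fix P Q assume "\<forall>\<^sub>F x in F. \<forall>\<^sub>F y in G. P (x + y)" "\<forall>\<^sub>F x in F. \<forall>\<^sub>F y in G. Q (x + y)"
  then show "\<forall>\<^sub>F x in F. \<forall>\<^sub>F y in G. P (x + y) \<and> Q (x + y)"
    by eventually_elim (rule eventually_conj)
next
  fix P Q assume "\<forall>x. P x \<longrightarrow> Q x" "\<forall>\<^sub>F x in F. \<forall>\<^sub>F y in G. P (x + y)"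
  then show "\<forall>\<^sub>F x in F. \<forall>\<^sub>F y in G. Q (x + y)"
    by (auto elim!: eventually_mono)
qed auto

lemma filter_add_mono: "F \<le> F' \<Longrightarrow> G \<le> G' \<Longrightarrow> filter_add F G \<le> filter_add F' G'"
  unfolding le_filter_def eventually_filter_add by (meson eventually_mono)

lemma filter_add_assoc:
  fixes F G H :: "'a::semigroup_add filter"
  shows "filter_add (filter_add F G) H = filter_add F (filter_add G H)"
  by (simp add: filter_eq_iff eventually_filter_add add.assoc)

lemma filter_add_neq_bot: "F \<noteq> bot \<Longrightarrow> G \<noteq> bot \<Longrightarrow> filter_add F G \<noteq> bot"
  by (simp add: trivial_limit_def eventually_filter_add)

text \<open>This replaces the theorem of Ellis and Numakura: the filter \<open>M\<close> is a minimal element of the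
  set of proper filters that contain their own sum. For an ultrafilter \<open>q\<close> below \<open>M\<close>, minimality
  gives first \<open>M + q = M\<close> and then \<open>M = H\<close>, where \<open>H\<close> is the coarsest filter below \<open>M\<close>
  with \<open>H + q \<le> q\<close>; hence \<open>M = q\<close>.\<close>
theorem subidempotent_ultra_below:
  fixes F0 :: "'a::semigroup_add filter"
  assumes "F0 \<noteq> bot" "filter_add F0 F0 \<le> F0"
  obtains M where "ultra M" "M \<le> F0" "filter_add M M \<le> M"
proof -
  let ?Q = "\<lambda>F :: 'a filter. F \<noteq> bot \<and> filter_add F F \<le> F"
  obtain M where M: "M \<noteq> bot" "filter_add M M \<le> M" "M \<le> F0"
    and min: "\<And>G. G \<noteq> bot \<Longrightarrow> filter_add G G \<le> G \<Longrightarrow> G \<le> M \<Longrightarrow> G = M"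
  proof (rule minimal_filter_exists[of ?Q F0])
    fix B :: "'a filter set"
    assume B: "B \<noteq> {}" "\<And>F. F \<in> B \<Longrightarrow> ?Q F"
      and ev: "\<And>P. eventually P (Inf B) \<longleftrightarrow> (\<exists>F\<in>B. eventually P F)"
    have "Inf B \<noteq> bot"
      using B(2) by (auto simp: trivial_limit_def ev)
    moreover have "filter_add (Inf B) (Inf B) \<le> Inf B"
    proof (rule Inf_greatest)
      fix F assume "F \<in> B"
      then have "filter_add (Inf B) (Inf B) \<le> filter_add F F"
        by (intro filter_add_mono Inf_lower)
      also have "\<dots> \<le> F" using B(2) \<open>F \<in> B\<close> by blast
      finally show "filter_add (Inf B) (Inf B) \<le> F" .
    qed
    ultimately show "?Q (Inf B)" by blast
  qed (use assms in auto)
  obtain q where q: "ultra q" "q \<le> M"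
    using ultra_below[OF M(1)] by blast
  have qnb: "q \<noteq> bot" using q(1) by (simp add: ultra_def)
  have Mq: "filter_add M q = M"
  proof (rule min)
    \<comment> \<open>Reassociation exposes the middle term \<open>filter_add q M\<close>, which
      lies below \<open>filter_add M M\<close> and so below \<open>M\<close>.\<close>
    have "filter_add (filter_add M q) (filter_add M q) = filter_add M (filter_add (filter_add q M) q)"
      by (simp add: filter_add_assoc)
    also have "\<dots> \<le> filter_add M (filter_add (filter_add M M) q)"
      using q(2) by (intro filter_add_mono order_refl)
    also have "\<dots> \<le> filter_add M (filter_add M q)"
      using M(2) by (intro filter_add_mono order_refl)
    also have "\<dots> = filter_add (filter_add M M) q"
      by (simp add: filter_add_assoc)
    also have "\<dots> \<le> filter_add M q"
      using M(2) by (intro filter_add_mono order_refl)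
    finally show "filter_add (filter_add M q) (filter_add M q) \<le> filter_add M q" .
    have "filter_add M q \<le> filter_add M M"
      using q(2) by (intro filter_add_mono order_refl)
    with M(2) show "filter_add M q \<le> M" by (rule order_trans[rotated])
  qed (simp add: filter_add_neq_bot M qnb)

  \<comment> \<open>Besides the members of \<open>M\<close>, the sets of all \<open>x\<close> with
    \<open>\<forall>\<^sub>F y in q. A (x + y)\<close>, for \<open>A\<close> in \<open>q\<close>,
    are forced into \<open>H\<close>. One \<open>A\<close> suffices because two can be replaced by
    their conjunction.\<close>
  define H where "H = Abs_filter (\<lambda>P. \<exists>A. eventually A q \<and>
    (\<forall>\<^sub>F x in M. (\<forall>\<^sub>F y in q. A (x + y)) \<longrightarrow> P x))"
  have evH: "eventually P H \<longleftrightarrow>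
      (\<exists>A. eventually A q \<and> (\<forall>\<^sub>F x in M. (\<forall>\<^sub>F y in q. A (x + y)) \<longrightarrow> P x))" for P
    unfolding H_def
  proof (rule eventually_Abs_filter, rule is_filter.intro)
    fix P Q
    assume "\<exists>A. eventually A q \<and> (\<forall>\<^sub>F x in M. (\<forall>\<^sub>F y in q. A (x + y)) \<longrightarrow> P x)"
      and "\<exists>A. eventually A q \<and> (\<forall>\<^sub>F x in M. (\<forall>\<^sub>F y in q. A (x + y)) \<longrightarrow> Q x)"
    then obtain A B where A: "eventually A q" "\<forall>\<^sub>F x in M. (\<forall>\<^sub>F y in q. A (x + y)) \<longrightarrow> P x"
      and B: "eventually B q" "\<forall>\<^sub>F x in M. (\<forall>\<^sub>F y in q. B (x + y)) \<longrightarrow> Q x" by blast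
    have "\<forall>\<^sub>F x in M. (\<forall>\<^sub>F y in q. A (x + y) \<and> B (x + y)) \<longrightarrow> P x \<and> Q x"
      using A(2) B(2) by eventually_elim (auto simp: eventually_conj_iff)
    then show "\<exists>A. eventually A q \<and> (\<forall>\<^sub>F x in M. (\<forall>\<^sub>F y in q. A (x + y)) \<longrightarrow> P x \<and> Q x)"
      using A(1) B(1) by (intro exI[of _ "\<lambda>x. A x \<and> B x"]) (auto simp: eventually_conj_iff)
  next
    fix P Q assume PQ: "\<forall>x. P x \<longrightarrow> Q x"
      and "\<exists>A. eventually A q \<and> (\<forall>\<^sub>F x in M. (\<forall>\<^sub>F y in q. A (x + y)) \<longrightarrow> P x)"
    then obtain A where A: "eventually A q" "\<forall>\<^sub>F x in M. (\<forall>\<^sub>F y in q. A (x + y)) \<longrightarrow> P x"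
      by blast
    from A(2) have "\<forall>\<^sub>F x in M. (\<forall>\<^sub>F y in q. A (x + y)) \<longrightarrow> Q x"
      by (rule eventually_mono) (use PQ in blast)
    with A(1) show "\<exists>A. eventually A q \<and> (\<forall>\<^sub>F x in M. (\<forall>\<^sub>F y in q. A (x + y)) \<longrightarrow> Q x)"
      by blast
  qed (simp add: exI[of _ "\<lambda>_. True"])
  have H_le: "H \<le> M"
    unfolding le_filter_def evH by (auto intro!: exI[of _ "\<lambda>_. True"] elim: eventually_mono)
  have H_shift: "\<forall>\<^sub>F x in H. \<forall>\<^sub>F y in q. A (x + y)" if "eventually A q" for A
    using that by (auto simp: evH)
  have "H = M"
  proof (rule min)
    \<comment> \<open>If some \<open>A\<close> in \<open>q\<close> failed this demand for almost all
      \<open>x\<close>, then, \<open>q\<close> being an ultrafilter, \<open>\<not> A\<close> would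
      belong to \<open>filter_add M q = M\<close> and hence to \<open>q\<close>.\<close>
    show "H \<noteq> bot"
    proof
      assume "H = bot"
      then obtain A where A: "eventually A q" "\<forall>\<^sub>F x in M. \<not> (\<forall>\<^sub>F y in q. A (x + y))"
        using evH[of "\<lambda>_. False"] by auto
      have "\<forall>\<^sub>F x in M. \<forall>\<^sub>F y in q. \<not> A (x + y)"
        using A(2) by (rule eventually_mono) (use q(1) in \<open>auto simp: ultra_def\<close>)
      then have "\<forall>\<^sub>F x in M. \<not> A x"
        using Mq eventually_filter_add[of "\<lambda>x. \<not> A x" M q] by simp
      then have "\<forall>\<^sub>F x in q. \<not> A x"
        using q(2) by (simp add: le_filter_def)
      with A(1) have "\<forall>\<^sub>F x in q. False" by eventually_elim simp
      with qnb show False by simp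
    qed
    show "filter_add H H \<le> H"
      unfolding le_filter_def
    proof (intro allI impI)
      fix P assume "eventually P H"
      then obtain A where A: "eventually A q"
        "\<forall>\<^sub>F x in M. (\<forall>\<^sub>F y in q. A (x + y)) \<longrightarrow> P x" by (auto simp: evH)
      have "\<forall>\<^sub>F x in M. \<forall>\<^sub>F y in M. (\<forall>\<^sub>F z in q. A (x + y + z)) \<longrightarrow> P (x + y)"
        using filter_leD[OF M(2) A(2)] by (simp add: eventually_filter_add)
      then have "\<forall>\<^sub>F x in H. \<forall>\<^sub>F y in M. (\<forall>\<^sub>F z in q. A (x + y + z)) \<longrightarrow> P (x + y)"
        using H_le by (simp add: le_filter_def)
      moreover have "\<forall>\<^sub>F x in H. \<forall>\<^sub>F y in q. A (x + y)"
        by (rule H_shift[OF A(1)])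
      ultimately have "\<forall>\<^sub>F x in H. \<forall>\<^sub>F y in H. P (x + y)"
      proof eventually_elim
        case (elim x)
        \<comment> \<open>For this \<open>x\<close> the translated predicate
          \<open>A (x + z)\<close> is itself in \<open>q\<close>, so it serves as the witness in
          \<open>evH\<close>.\<close>
        then show ?case
          unfolding evH by (intro exI[of _ "\<lambda>z. A (x + z)"]) (simp add: add.assoc)
      qed
      then show "eventually P (filter_add H H)"
        by (simp add: eventually_filter_add)
    qed
  qed (rule H_le)
  have "M \<le> q"
    unfolding le_filter_def
  proof (intro allI impI)
    fix A assume "eventually A q"
    then have "\<forall>\<^sub>F x in M. \<forall>\<^sub>F y in q. A (x + y)"
      using H_shift \<open>H = M\<close> by blast
    then show "eventually A M"
      using Mq eventually_filter_add[of A M q] by simp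
  qed
  with q have "ultra M" by (metis order_antisym)
  with M that show thesis by blast
qed

subsection \<open>The ideal \<open>NC\<close>\<close>

lemma nowhere_dense_Un:
  assumes "nowhere_dense A" "nowhere_dense B"
  shows "nowhere_dense (A \<union> B)"
  using assms interior_closed_Un_empty_interior[OF closed_closure, of "closure B" A]
  by (simp add: nowhere_dense_def)

lemma nowhere_dense_UN:
  assumes "finite I" "\<And>i. i \<in> I \<Longrightarrow> nowhere_dense (f i)"
  shows "nowhere_dense (\<Union>i\<in>I. f i)"
  using assms by induction (auto intro: nowhere_dense_Un simp: nowhere_dense_def[of "{}"])

lemma nowhere_dense_translation:
  fixes A :: "'a::real_normed_vector set"
  shows "nowhere_dense ((+) a ` A) \<longleftrightarrow> nowhere_dense A"
  by (simp add: nowhere_dense_def interior_translation closure_translation)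

lemma NC_subset: "A \<in> NC \<Longrightarrow> B \<subseteq> A \<Longrightarrow> B \<in> NC"
  unfolding NC_def by blast

lemma NC_Un: "A \<in> NC \<Longrightarrow> B \<in> NC \<Longrightarrow> A \<union> B \<in> NC"
proof -
  assume "A \<in> NC" "B \<in> NC"
  then obtain K N K' N' where "compact K" "nowhere_dense N" "A \<subseteq> K \<union> N"
    "compact K'" "nowhere_dense N'" "B \<subseteq> K' \<union> N'"
    by (auto simp: NC_def)
  then show ?thesis
    unfolding NC_def mem_Collect_eq
    by (intro exI[of _ "K \<union> K'"] exI[of _ "N \<union> N'"]) (auto intro: nowhere_dense_Un)
qed

lemma NC_compact: "compact K \<Longrightarrow> K \<in> NC"
  unfolding NC_def mem_Collect_eq
  by (intro exI[of _ K] exI[of _ "{}"]) (simp add: nowhere_dense_def)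

lemma NC_translation:
  fixes A :: "'a::real_normed_vector set"
  assumes "A \<in> NC"
  shows "(+) a ` A \<in> NC"
proof -
  obtain K N where "compact K" "nowhere_dense N" "A \<subseteq> K \<union> N"
    using assms by (auto simp: NC_def)
  then show ?thesis
    unfolding NC_def mem_Collect_eq
    by (intro exI[of _ "(+) a ` K"] exI[of _ "(+) a ` N"])
       (auto intro: compact_translation simp: nowhere_dense_translation)
qed

text \<open>If \<open>S\<close> were covered by a compact \<open>K\<close> and a nowhere dense
  \<open>N\<close>, then \<open>Q - K\<close> would be an open subset of \<open>closure N\<close>,
  hence empty, and \<open>Q\<close> would be bounded.\<close>

lemma not_NC_if_dense_in:
  fixes S :: "'a::real_normed_vector set"
  assumes "open Q" "\<not> bounded Q" "dense_in S Q"
  shows "S \<notin> NC"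
proof
  assume "S \<in> NC"
  then obtain K N where KN: "compact K" "nowhere_dense N" "S \<subseteq> K \<union> N"
    by (auto simp: NC_def)
  have "Q \<subseteq> closure (K \<union> N)"
    using assms(3) KN(3) closure_mono[of "S \<inter> Q" "K \<union> N"] unfolding dense_in_def by blast
  then have "Q - K \<subseteq> closure N"
    using KN(1) by (auto simp: compact_imp_closed)
  then have "Q - K \<subseteq> interior (closure N)"
    using assms(1) KN(1) by (intro interior_maximal open_Diff compact_imp_closed)
  then have "Q \<subseteq> K"
    using KN(2) by (auto simp: nowhere_dense_def)
  then show False
    using assms(2) KN(1) bounded_subset compact_imp_bounded by blast
qed

text \<open>The open set is the interior of the closure of \<open>S\<close>. Were it bounded, the
  part of \<open>S\<close> outside a large closed ball would be nowhere dense.\<close>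

lemma dense_in_if_not_NC:
  fixes S :: "'a::euclidean_space set"
  assumes "S \<notin> NC"
  obtains Q where "open Q" "\<not> bounded Q" "dense_in S Q"
proof -
  let ?Q = "interior (closure S)"
  have "dense_in S ?Q"
    unfolding dense_in_def
    by (metis Int_absorb2 Int_commute interior_subset open_Int_closure_subset open_interior)
  moreover have "\<not> bounded ?Q"
  proof
    assume "bounded ?Q"
    then obtain R where R: "?Q \<subseteq> ball 0 R"
      using bounded_subset_ballD by blast
    let ?T = "S - cball 0 R"
    have "interior (closure ?T) \<subseteq> ?Q"
      by (intro interior_mono closure_mono) auto
    moreover have "closure ?T \<subseteq> - ball 0 R"
      by (intro closure_minimal) auto
    ultimately have "interior (closure ?T) = {}"
      using R interior_subset[of "closure ?T"] by blast
    then have "S \<in> NC"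
      unfolding NC_def mem_Collect_eq nowhere_dense_def
      by (intro exI[of _ "cball 0 R"] exI[of _ ?T]) auto
    with assms show False ..
  qed
  ultimately show thesis
    using that open_interior by blast
qed

lemma nonempty_open_minus_nowhere_dense:
  assumes "open V" "V \<noteq> {}" "nowhere_dense N"
  shows "V - closure N \<noteq> {}"
  using assms interior_maximal[of V "closure N"] by (auto simp: nowhere_dense_def)

subsection \<open>The set \<open>P\<close>\<close>

lemma pos_rat_vectors_add: "x \<in> pos_rat_vectors \<Longrightarrow> y \<in> pos_rat_vectors \<Longrightarrow> x + y \<in> pos_rat_vectors"
  by (auto simp: pos_rat_vectors_def intro: add_pos_pos)

lemma countable_pos_rat_vectors: "countable (pos_rat_vectors :: (real ^ 'n::finite) set)"
proof (rule countable_subset)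
  show "pos_rat_vectors \<subseteq> range (\<lambda>f :: 'n \<Rightarrow> rat. \<chi> i. of_rat (f i))"
  proof
    fix x :: "real ^ 'n" assume "x \<in> pos_rat_vectors"
    then have "\<forall>i. \<exists>q. x $ i = of_rat q"
      by (auto simp: pos_rat_vectors_def Rats_def)
    then obtain f where "\<forall>i. x $ i = of_rat (f i)" by metis
    then show "x \<in> range (\<lambda>f :: 'n \<Rightarrow> rat. \<chi> i. of_rat (f i))"
      by (auto simp: vec_eq_iff)
  qed
qed simp

lemma closure_rational_vectors: "closure {x :: real ^ 'n::finite. \<forall>i. x $ i \<in> \<rat>} = UNIV"
proof -
  have "(\<Sum>b\<in>Basis. f b *\<^sub>R b) $ i \<in> \<rat>" if "f \<in> Basis \<rightarrow> \<rat>" for f :: "real ^ 'n \<Rightarrow> real" and i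
  proof -
    have "(\<Sum>b\<in>Basis. f b *\<^sub>R b) $ i = f (axis i 1)"
      by (simp add: cart_eq_inner_axis inner_sum_left inner_Basis if_distrib[of "\<lambda>x. _ * x"] cong: if_cong)
    then show ?thesis using that by (auto simp: Pi_iff)
  qed
  then have "(\<Union>f \<in> Basis \<rightarrow> \<rat>. {\<Sum>b :: real ^ 'n\<in>Basis. f b *\<^sub>R b}) \<subseteq> {x. \<forall>i. x $ i \<in> \<rat>}"
    by auto
  from closure_mono[OF this] show ?thesis
    by (simp add: closure_rational_coordinates top.extremum_unique)
qed

section \<open>Additive exhaustions and sums along increasing stages\<close>

lemma finite_additive_exhaustion:
  fixes Z N :: "'a::monoid_add set"
  assumes "countable Z" "Z \<subseteq> N" "0 \<in> N" "\<And>x y. x \<in> N \<Longrightarrow> y \<in> N \<Longrightarrow> x + y \<in> N"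
  obtains W :: "nat \<Rightarrow> 'a set" where "\<And>k. finite (W k)" "\<And>k. 0 \<in> W k" "\<And>k. W k \<subseteq> N" "mono W"
    "\<And>k x y. x \<in> W k \<Longrightarrow> y \<in> W k \<Longrightarrow> x + y \<in> W (Suc k)" "Z \<subseteq> (\<Union>k. W k)"
proof -
  obtain z :: "nat \<Rightarrow> 'a" where z: "range z = insert 0 Z"
    using assms(1) by (metis countable_insert range_from_nat_into insert_not_empty)
  \<comment> \<open>Each stage adds one enumerated element and all sums of two old elements. As
    \<open>0\<close> is present from the start, the stages increase.\<close>
  define W where "W = rec_nat {0 :: 'a} (\<lambda>k A. insert (z k) (case_prod (+) ` (A \<times> A)))"
  have W0: "W 0 = {0}" and WSuc: "\<And>k. W (Suc k) = insert (z k) (case_prod (+) ` (W k \<times> W k))"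
    by (simp_all add: W_def)
  have fin: "finite (W k)" for k
    by (induction k) (simp_all add: W0 WSuc)
  have zero: "0 \<in> W k" for k
    by (induction k) (force simp: W0 WSuc)+
  have add: "x + y \<in> W (Suc k)" if "x \<in> W k" "y \<in> W k" for k x y
    using that by (auto simp: WSuc)
  have "z k \<in> N" for k
    using z assms by (metis insert_subset rangeI subsetD)
  then have sub: "W k \<subseteq> N" for k
    by (induction k) (auto simp: W0 WSuc assms subset_iff)
  have "mono W"
    unfolding mono_iff_le_Suc using add zero by (metis add_0_right subsetI)
  moreover have "Z \<subseteq> (\<Union>k. W k)"
  proof
    fix x assume "x \<in> Z"
    then obtain k where "x = z k" using z by (metis insertI2 rangeE)
    then have "x \<in> W (Suc k)" by (simp add: WSuc)
    then show "x \<in> (\<Union>k. W k)" by blast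
  qed
  ultimately show thesis
    using that fin zero add sub by blast
qed

text \<open>The number \<open>m\<close> bounds the stage of the first summand from below. A summand
  \<open>b\<close> is placed in some \<open>W j\<close>, and the next one comes from stage
  \<open>Suc j\<close> or later: the successor leaves room for adding \<open>b\<close> to another
  element of \<open>W j\<close>.\<close>

inductive chain_sum :: "(nat \<Rightarrow> 'a set) \<Rightarrow> (nat \<Rightarrow> 'a set) \<Rightarrow> nat \<Rightarrow> 'a::semigroup_add \<Rightarrow> bool"
  for B W where
  single: "m \<le> k \<Longrightarrow> b \<in> B k \<Longrightarrow> chain_sum B W m b"
| step: "m \<le> k \<Longrightarrow> b \<in> B k \<Longrightarrow> k \<le> j \<Longrightarrow> b \<in> W j \<Longrightarrow> chain_sum B W (Suc j) y \<Longrightarrow>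
    chain_sum B W m (b + y)"

lemma chain_sum_antimono: "chain_sum B W m x \<Longrightarrow> l \<le> m \<Longrightarrow> chain_sum B W l x"
  by (erule chain_sum.cases) (auto intro: chain_sum.intros order_trans)

text \<open>The last summand of \<open>x\<close> lies in some \<open>W j\<close>, and every chain
  sum that starts at \<open>Suc j\<close> can be appended after it.\<close>

lemma chain_sum_shift:
  assumes "chain_sum B W m x" and "\<And>k b. b \<in> B k \<Longrightarrow> \<exists>j\<ge>k. b \<in> W j"
  shows "\<exists>l. \<forall>y. chain_sum B W l y \<longrightarrow> chain_sum B W m (x + y)"
  using assms(1)
proof induction
  case (single m k b)
  then show ?case using assms(2)[OF single(2)] by (meson chain_sum.step)
next
  case (step m k b j y)
  then show ?case by (metis add.assoc chain_sum.step)
qed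

text \<open>The summands are absorbed into \<open>w\<close> from the left: \<open>w + b\<close> lies
  in \<open>W (Suc j)\<close>, where the rest of the chain begins. In the end only the last summand
  remains.\<close>

lemma chain_sum_add_mem:
  assumes "chain_sum B W m y" "w \<in> W m" and "mono W"
    and "\<And>k x y. x \<in> W k \<Longrightarrow> y \<in> W k \<Longrightarrow> x + y \<in> W (Suc k)"
    and "\<And>k w b. w \<in> W k \<Longrightarrow> b \<in> B k \<Longrightarrow> w + b \<in> X"
  shows "w + y \<in> X"
  using assms(1,2)
proof (induction arbitrary: w)
  case (single m k b)
  then show ?case using assms(3,5) by (meson monoD subsetD)
next
  case (step m k b j y)
  then have "w \<in> W j" using assms(3) by (meson monoD order_trans subsetD)
  then have "w + b \<in> W (Suc j)" using assms(4) step by blast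
  from step.IH[OF this] show ?case by (simp add: add.assoc)
qed

lemma chain_sum_closed:
  assumes "chain_sum B W m x" "\<And>k. B k \<subseteq> N" "\<And>x y. x \<in> N \<Longrightarrow> y \<in> N \<Longrightarrow> x + y \<in> N"
  shows "x \<in> N"
  using assms(1) by induction (use assms(2,3) in blast)+

text \<open>The last clause will make the filter generated by the sets \<open>S m\<close> contain
  its own sum, and \<open>S m \<notin> NC\<close> will keep it proper modulo
  \<open>NC\<close>.\<close>

lemma NC_avoiding_additive_tails:
  fixes C :: "(real ^ 'n::finite) set"
  assumes "C \<in> NC"
  obtains P and S :: "nat \<Rightarrow> (real ^ 'n) set" where
    "open P" "C \<subseteq> P" "P \<notin> NC" "decseq S"
    "\<And>m. S m \<subseteq> pos_rat_vectors - P" "\<And>m. S m \<notin> NC"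
    "\<And>m x. x \<in> S m \<Longrightarrow> \<exists>l. \<forall>y\<in>S l. x + y \<in> S m"
proof -
  obtain K N where K: "compact K" and N: "nowhere_dense N" and CKN: "C \<subseteq> K \<union> N"
    using assms by (auto simp: NC_def)
  obtain R where R: "\<And>x. x \<in> K \<Longrightarrow> norm x \<le> R"
    using K by (meson bounded_iff compact_imp_bounded)
  obtain W :: "nat \<Rightarrow> (real ^ 'n) set" where W: "\<And>k. finite (W k)" "\<And>k. 0 \<in> W k"
    "\<And>k. W k \<subseteq> {x. \<forall>i. 0 \<le> x $ i}" "mono W"
    "\<And>k x y. x \<in> W k \<Longrightarrow> y \<in> W k \<Longrightarrow> x + y \<in> W (Suc k)"
    "pos_rat_vectors \<subseteq> (\<Union>k. W k)"
    by (rule finite_additive_exhaustion[OF countable_pos_rat_vectors,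
          of "{x :: real ^ 'n. \<forall>i. 0 \<le> x $ i}"])
       (auto simp: pos_rat_vectors_def less_imp_le)
  \<comment> \<open>The large coordinates avoid \<open>K\<close> and drive the balls to infinity;
    avoiding \<open>N\<close> means staying outside finitely many translates of it. The absolute
    value matters when \<open>K\<close> is empty, as \<open>R\<close> may then be negative.\<close>
  have "\<exists>c r. 0 < r \<and> (\<forall>x\<in>cball c r. (\<forall>i. real k + \<bar>R\<bar> < x $ i) \<and> (\<forall>w\<in>W k. w + x \<notin> N))" for k
  proof -
    let ?V = "{x :: real ^ 'n. \<forall>i. real k + \<bar>R\<bar> < x $ i}"
    let ?N = "\<Union>w\<in>W k. (+) (- w) ` N"
    have "?V = (\<Inter>i. {x. real k + \<bar>R\<bar> < x $ i})" by auto
    then have V: "open ?V"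
      by (simp add: open_INT open_halfspace_component_gt_cart)
    have "(\<chi> i. real k + \<bar>R\<bar> + 1) \<in> ?V" by simp
    then have "?V \<noteq> {}" by blast
    moreover have "nowhere_dense ?N"
      using W(1) N by (intro nowhere_dense_UN) (simp_all only: nowhere_dense_translation)
    ultimately obtain c where "c \<in> ?V - closure ?N"
      using nonempty_open_minus_nowhere_dense[OF V] by blast
    moreover have "open (?V - closure ?N)"
      using V by (intro open_Diff) auto
    ultimately obtain r where r: "0 < r" "cball c r \<subseteq> ?V - closure ?N"
      using open_contains_cball by blast
    have "w + x \<notin> N" if "x \<in> cball c r" "w \<in> W k" for x w
    proof
      assume "w + x \<in> N"
      then have "- w + (w + x) \<in> ?N" using that(2) by blast
      then have "x \<in> closure ?N" using closure_subset[of ?N] by auto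
      then show False using r that by blast
    qed
    then show ?thesis using r by blast
  qed
  then obtain c r where r: "\<And>k. 0 < r k"
    and far: "\<And>k x i. x \<in> cball (c k) (r k) \<Longrightarrow> real k + \<bar>R\<bar> < x $ i"
    and avoid: "\<And>k x w. x \<in> cball (c k) (r k) \<Longrightarrow> w \<in> W k \<Longrightarrow> w + x \<notin> N"
    by metis
  have far_add: "real k + \<bar>R\<bar> < (w + x) $ i" if "x \<in> cball (c k) (r k)" "w \<in> W k" for k x w i
  proof -
    have "0 \<le> w $ i" using W(3)[of k] that(2) by blast
    then show ?thesis using far[OF that(1), of i] by simp
  qed
  define X where "X = (\<Union>k. \<Union>w\<in>W k. (+) w ` cball (c k) (r k))"
  have X_E: thesis if "x \<in> X"
    "\<And>k w b. x = w + b \<Longrightarrow> w \<in> W k \<Longrightarrow> b \<in> cball (c k) (r k) \<Longrightarrow> thesis" for x thesis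
    using that(1) unfolding X_def by (elim UN_E imageE) (rule that(2))
  define B where "B k = pos_rat_vectors \<inter> ball (c k) (r k)" for k
  define S where "S m = Collect (chain_sum B W m)" for m
  \<comment> \<open>Index types are nonempty, so some coordinate can be fixed.\<close>
  obtain i :: 'n where True by blast
  \<comment> \<open>The union is locally finite: where coordinate \<open>i\<close> is less than
    \<open>k0\<close>, only the finitely many closed balls with \<open>k < k0\<close> occur.\<close>
  have "closed X"
  proof -
    have "x \<in> X" if "x \<in> closure X" for x
    proof -
      obtain k0 :: nat where k0: "x $ i < real k0" using reals_Archimedean2 by blast
      let ?V = "{y :: real ^ 'n. y $ i < real k0}"
      let ?Y = "\<Union>k\<in>{..<k0}. \<Union>w\<in>W k. (+) w ` cball (c k) (r k)"
      have "?V \<inter> X \<subseteq> ?Y"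
      proof
        fix y assume "y \<in> ?V \<inter> X"
        then have "y \<in> X" and yi: "y $ i < real k0" by simp_all
        obtain k w b where y: "y = w + b" "w \<in> W k" "b \<in> cball (c k) (r k)"
          using X_E[OF \<open>y \<in> X\<close>] .
        then have "k < k0" using far_add[of b k w i] yi by simp
        with y show "y \<in> ?Y" by blast
      qed
      moreover have "closed ?Y"
        by (intro closed_UN ballI W finite_lessThan closed_translation closed_cball)
      ultimately have "closure (?V \<inter> X) \<subseteq> ?Y" by (rule closure_minimal)
      moreover have "x \<in> closure (?V \<inter> X)"
        using open_halfspace_component_lt_cart that k0
        by (intro subsetD[OF open_Int_closure_subset]) auto
      ultimately have "x \<in> ?Y" by (rule subsetD)
      then show ?thesis by (auto simp only: X_def)
    qed
    then have "closure X = X" using closure_subset by blast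
    then show ?thesis by (metis closed_closure)
  qed
  then have "open (- X)" by (rule open_Compl)
  moreover have "C \<subseteq> - X"
  proof (intro subsetI ComplI)
    fix x assume "x \<in> C" "x \<in> X"
    obtain k w b where x: "x = w + b" "w \<in> W k" "b \<in> cball (c k) (r k)"
      using X_E[OF \<open>x \<in> X\<close>] .
    have "R < x $ i" using far_add[OF x(3,2), of i] x(1) by simp
    then have "x \<notin> K" using R[of x] component_le_norm_cart[of x i] by linarith
    moreover have "x \<notin> N" using avoid[OF x(3,2)] x(1) by simp
    ultimately show False using \<open>x \<in> C\<close> CKN by blast
  qed
  \<comment> \<open>All points of \<open>X\<close> have positive coordinates, so \<open>- X\<close>
    contains an unbounded open half-space.\<close>
  moreover have "- X \<notin> NC"
  proof
    let ?Q = "{x :: real ^ 'n. x $ i < 0}"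
    assume "- X \<in> NC"
    moreover have "?Q \<subseteq> - X"
    proof (intro subsetI ComplI)
      fix x assume "x \<in> ?Q" "x \<in> X"
      obtain k w b where x: "x = w + b" "w \<in> W k" "b \<in> cball (c k) (r k)"
        using X_E[OF \<open>x \<in> X\<close>] .
      with far_add[OF x(3,2), of i] \<open>x \<in> ?Q\<close> show False by simp
    qed
    ultimately have "?Q \<in> NC" by (rule NC_subset)
    moreover have "\<not> bounded ?Q"
    proof
      assume "bounded ?Q"
      then obtain b where b: "\<And>x :: real ^ 'n. x $ i < 0 \<Longrightarrow> norm x \<le> b"
        unfolding bounded_iff by blast
      let ?z = "(\<chi> j. - \<bar>b\<bar> - 1) :: real ^ 'n"
      have z: "?z $ i = - \<bar>b\<bar> - 1" by simp
      then have "norm ?z \<le> b" by (intro b) linarith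
      then show False using component_le_norm_cart[of ?z i] z by linarith
    qed
    ultimately show False
      using not_NC_if_dense_in[of ?Q ?Q] closure_subset[of ?Q]
      by (simp add: dense_in_def open_halfspace_component_lt_cart)
  qed
  moreover have "decseq S"
    by (auto simp: decseq_def S_def intro: chain_sum_antimono)
  moreover have "S m \<subseteq> pos_rat_vectors - (- X)" for m
  proof -
    have "x \<in> pos_rat_vectors" if "chain_sum B W m x" for x
      by (rule chain_sum_closed[OF that]) (auto simp: B_def pos_rat_vectors_add)
    moreover have "0 + x \<in> X" if "chain_sum B W m x" for x
    proof (rule chain_sum_add_mem[OF that W(2) W(4,5)])
      fix k w b assume "w \<in> W k" "b \<in> B k"
      then have "b \<in> cball (c k) (r k)" by (simp add: B_def)
      with \<open>w \<in> W k\<close> show "w + b \<in> X" unfolding X_def by blast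
    qed
    ultimately show ?thesis by (auto simp: S_def)
  qed
  moreover have "S m \<notin> NC" for m
  proof -
    \<comment> \<open>Rational points of these balls are chain sums with a single summand, and they
      are dense in the unbounded union.\<close>
    let ?Q = "\<Union>k\<in>{m..}. ball (c k) (r k)"
    have "\<not> bounded ?Q"
    proof
      assume "bounded ?Q"
      then obtain b where b: "\<And>x. x \<in> ?Q \<Longrightarrow> norm x \<le> b"
        unfolding bounded_iff by blast
      obtain k :: nat where "b < real k" using reals_Archimedean2 by blast
      then have k: "b < real (max k m)" by simp
      have "c (max k m) \<in> ball (c (max k m)) (r (max k m))" using r by simp
      then have "c (max k m) \<in> ?Q" by (rule UN_I[rotated]) simp
      from b[OF this] show False
        using k far[of "c (max k m)" "max k m" i] r[of "max k m"]
          component_le_norm_cart[of "c (max k m)" i] by simp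
    qed
    moreover have "dense_in (S m) ?Q"
      unfolding dense_in_def
    proof
      fix x assume "x \<in> ?Q"
      then obtain k where k: "m \<le> k" "x \<in> ball (c k) (r k)" by auto
      have "x \<in> closure (ball (c k) (r k) \<inter> {x. \<forall>i. x $ i \<in> \<rat>})"
        using open_Int_closure_subset[OF open_ball, of "c k" "r k" "{x. \<forall>i. x $ i \<in> \<rat>}"] k(2)
        by (auto simp: closure_rational_vectors)
      moreover have "ball (c k) (r k) \<inter> {x. \<forall>i. x $ i \<in> \<rat>} \<subseteq> S m \<inter> ?Q"
      proof
        fix y assume y: "y \<in> ball (c k) (r k) \<inter> {x. \<forall>i. x $ i \<in> \<rat>}"
        then have "0 < y $ i" for i
          using far[of y k i] by (simp add: less_imp_le)
        then have "y \<in> B k" using y by (auto simp: B_def pos_rat_vectors_def)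
        then show "y \<in> S m \<inter> ?Q"
          using k(1) by (auto simp: S_def B_def intro: chain_sum.single)
      qed
      ultimately show "x \<in> closure (S m \<inter> ?Q)" using closure_mono by blast
    qed
    ultimately show ?thesis
      by (intro not_NC_if_dense_in[of ?Q]) auto
  qed
  moreover have "\<exists>l. \<forall>y\<in>S l. x + y \<in> S m" if "x \<in> S m" for m x
  proof -
    have "\<exists>j\<ge>k. b \<in> W j" if "b \<in> B k" for k b
    proof -
      obtain j where "b \<in> W j" using \<open>b \<in> B k\<close> W(6) by (auto simp: B_def)
      then have "b \<in> W (max j k)" using W(4) by (meson max.cobounded1 monoD subsetD)
      then show ?thesis using max.cobounded2 by blast
    qed
    with \<open>x \<in> S m\<close> show ?thesis
      using chain_sum_shift[of B W m x] by (auto simp: S_def)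
  qed
  ultimately show thesis by (rule that)
qed

subsection \<open>Families of \<open>FS\<close>-sets\<close>

lemma closed_discrete_if_locally_finite:
  fixes S :: "'a::metric_space set"
  assumes "\<And>x. finite (S \<inter> ball x 1)"
  shows "closed S \<and> discrete S"
proof -
  have "\<not> x islimpt S" for x
    using assms islimpt_eq_infinite_ball zero_less_one by blast
  then show ?thesis
    by (simp add: closed_limpt discrete_def isolated_in_islimpt_iff)
qed

text \<open>One element \<open>c t\<close> is chosen at a time, for the sequence with number \<open>\<pi> t\<close>. The first
  element of sequence \<open>i\<close> is taken from the \<open>i\<close>-th basic open subset of \<open>Q\<close>, all others are
  far away; avoiding all differences of earlier subset sums makes all subset sums distinct.\<close>
theorem dense_family_of_FS:
  fixes F :: "(real ^ 'n::finite) filter" and E :: "(real ^ 'n) set"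
  assumes F: "filter_add F F \<le> F" and notNC: "\<And>P. eventually P F \<Longrightarrow> {x. P x} \<notin> NC"
    and E: "\<forall>\<^sub>F x in F. x \<in> E" and nonneg: "\<And>x i. x \<in> E \<Longrightarrow> 0 \<le> x $ i"
    and NC_F: "\<And>A. A \<in> NC \<Longrightarrow> \<forall>\<^sub>F x in F. x \<notin> A"
  obtains a :: "nat \<Rightarrow> nat \<Rightarrow> real ^ 'n" and Q where
    "\<And>i. inj (a i)" "\<And>i. FS (a i) \<subseteq> E" "\<And>i. closed (FS (a i)) \<and> discrete (FS (a i))"
    "\<And>i j. i \<noteq> j \<Longrightarrow> FS (a i) \<inter> FS (a j) = {}"
    "open Q" "\<not> bounded Q" "dense_in (\<Union>i. FS (a i)) Q"
proof -
  define G where "G = {x \<in> E. \<forall>\<^sub>F y in F. x + y \<in> E}"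
  have ev_add: "\<forall>\<^sub>F x in F. \<forall>\<^sub>F y in F. x + y \<in> E"
    using filter_leD[OF F E] by (simp add: eventually_filter_add)
  then have G: "\<forall>\<^sub>F x in F. x \<in> G"
    using E by eventually_elim (simp add: G_def)
  \<comment> \<open>The set of \<open>y\<close> with \<open>x + y \<in> E\<close> belongs to
    \<open>F\<close>, so by \<open>filter_add F F \<le> F\<close> almost every \<open>y\<close>
    leaves \<open>x + y\<close> extendable again.\<close>
  have G_shift: "\<forall>\<^sub>F y in F. x + y \<in> G" if "x \<in> G" for x
  proof -
    have xE: "\<forall>\<^sub>F y in F. x + y \<in> E" using that by (simp add: G_def)
    then have "\<forall>\<^sub>F y in F. \<forall>\<^sub>F z in F. x + (y + z) \<in> E"
      using filter_leD[OF F xE] by (simp add: eventually_filter_add)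
    with xE show ?thesis by eventually_elim (simp add: G_def add.assoc)
  qed
  \<comment> \<open>Density is taken for \<open>G\<close> rather than \<open>E\<close>, because the
    first term of each sequence must be extendable.\<close>
  obtain Q where Q: "open Q" "\<not> bounded Q" "dense_in G Q"
    using dense_in_if_not_NC[of G] notNC[OF G] by auto

  obtain \<B> :: "(real ^ 'n) set set" where \<B>: "countable \<B>" "topological_basis \<B>"
    using ex_countable_basis by blast
  let ?\<B> = "{V \<in> \<B>. V \<noteq> {} \<and> V \<subseteq> Q}"
  have basis: "\<exists>V\<in>?\<B>. V \<subseteq> U" if U: "open U" "U \<subseteq> Q" "U \<noteq> {}" for U
  proof -
    obtain x where "x \<in> U" using U(3) by blast
    then obtain V where "V \<in> \<B>" "x \<in> V" "V \<subseteq> U"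
      using topological_basisE[OF \<B>(2) U(1)] by blast
    then show ?thesis using U(2) by blast
  qed
  have "Q \<noteq> {}" using Q(2) by auto
  then have "?\<B> \<noteq> {}" using basis[OF Q(1)] by blast
  moreover have "countable ?\<B>" using \<B>(1) by simp
  moreover define U where "U = from_nat_into ?\<B>"
  ultimately have U: "range U = ?\<B>"
    by (simp only: U_def range_from_nat_into not_False_eq_True)
  have U_mem: "U i \<in> ?\<B>" for i
    using rangeI[of U i] unfolding U .
  have U_open: "open (U i)" and U_ne: "U i \<noteq> {}" and U_sub: "U i \<subseteq> Q" for i
    using U_mem[of i] topological_basis_open[OF \<B>(2)] by simp_all

  define \<pi> where "\<pi> t = fst (prod_decode t)" for t
  let ?D = "\<lambda>c t. sum c ` Pow {..<t} :: (real ^ 'n) set"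
  \<comment> \<open>The second clause includes the empty \<open>A\<close>, which puts
    \<open>y\<close> itself into \<open>G\<close>. The case distinction separates the first term of
    a sequence from its later terms.\<close>
  define \<Phi> where "\<Phi> c t y \<longleftrightarrow>
      (\<forall>u\<in>?D c t. \<forall>v\<in>?D c t. y \<noteq> u - v) \<and>
      (\<forall>A. A \<subseteq> {s. s < t \<and> \<pi> s = \<pi> t} \<longrightarrow> sum c A + y \<in> G) \<and>
      (if \<exists>s<t. \<pi> s = \<pi> t then real t < norm y else y \<in> U (\<pi> t))" for c t y
  have \<Phi>_sum: "sum c A + y \<in> G" if "\<Phi> c t y" "A \<subseteq> {s. s < t \<and> \<pi> s = \<pi> t}" for c t y A
    using that unfolding \<Phi>_def by blast
  have below: "A - {s} \<subseteq> {s'. s' < s \<and> \<pi> s' = \<pi> s}"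
    if "s \<in> A" "\<And>s'. s' \<in> A \<Longrightarrow> s' \<le> s" "\<And>s'. s' \<in> A \<Longrightarrow> \<pi> s' = i" for A s i
    using that(1) that(2,3) le_neq_implies_less by fastforce
  have "\<exists>c. \<forall>t. \<Phi> c t (c t)"
  proof (rule dependent_wellorder_choice)
    fix r f g t assume eq: "\<And>s :: nat. s < t \<Longrightarrow> f s = (g s :: real ^ 'n)"
    have "?D f t = ?D g t"
      using eq by (intro image_cong sum.cong) auto
    moreover have "sum f A = sum g A" if "A \<subseteq> {s. s < t \<and> \<pi> s = \<pi> t}" for A
      using eq that by (intro sum.cong) auto
    ultimately show "\<Phi> f t r = \<Phi> g t r"
      by (simp add: \<Phi>_def)
  next
    fix t f assume IH: "\<And>s :: nat. s < t \<Longrightarrow> \<Phi> f s (f s)"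
    let ?T = "{s. s < t \<and> \<pi> s = \<pi> t}"
    let ?bad = "\<Union>u\<in>?D f t. \<Union>v\<in>?D f t. {u - v}"
    have bad: "finite ?bad" by simp
    show "\<exists>r. \<Phi> f t r"
    proof (cases "?T = {}")
      case True
      \<comment> \<open>A finite set is closed, so by density of \<open>G\<close> the nonempty open
        set \<open>U (\<pi> t)\<close> would itself be finite.\<close>
      have "\<not> U (\<pi> t) \<inter> G \<subseteq> ?bad"
      proof
        assume sub: "U (\<pi> t) \<inter> G \<subseteq> ?bad"
        have "U (\<pi> t) \<subseteq> U (\<pi> t) \<inter> closure G"
          using U_sub[of "\<pi> t"] Q(3) closure_mono[of "G \<inter> Q" G] unfolding dense_in_def by blast
        also have "\<dots> \<subseteq> closure (U (\<pi> t) \<inter> G)"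
          by (rule open_Int_closure_subset[OF U_open])
        also have "\<dots> \<subseteq> ?bad"
          using sub finite_imp_closed[OF bad] by (rule closure_minimal)
        finally have "finite (U (\<pi> t))" using bad finite_subset by blast
        then show False
          using U_open U_ne by (metis finite_imp_not_open)
      qed
      then obtain y where "y \<in> U (\<pi> t)" "y \<in> G" "y \<notin> ?bad" by blast
      moreover have "\<not> (\<exists>s<t. \<pi> s = \<pi> t)" using True by blast
      moreover have "sum f A + y \<in> G" if "A \<subseteq> ?T" for A
        using that True \<open>y \<in> G\<close> by simp
      moreover have "\<forall>u\<in>?D f t. \<forall>v\<in>?D f t. y \<noteq> u - v"
        using \<open>y \<notin> ?bad\<close> by blast
      ultimately have "\<Phi> f t y"
        unfolding \<Phi>_def by auto
      then show ?thesis ..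
    next
      case False
      have sums: "sum f A \<in> G" if "A \<subseteq> ?T" "A \<noteq> {}" for A
      proof -
        have fin: "finite A" using that(1) by (rule finite_subset) simp
        define s where "s = Max A"
        have s: "s \<in> A" "\<And>s'. s' \<in> A \<Longrightarrow> s' \<le> s"
          using fin that(2) by (auto simp: s_def)
        have "s < t" and A_t: "\<And>s'. s' \<in> A \<Longrightarrow> \<pi> s' = \<pi> t" using s(1) that(1) by auto
        have "sum f (A - {s}) + f s \<in> G"
          by (rule \<Phi>_sum[OF IH[OF \<open>s < t\<close>] below[OF s A_t]])
        then show ?thesis
          using fin s(1) by (simp add: sum.remove add.commute)
      qed
      have "\<forall>\<^sub>F y in F. \<forall>A\<in>Pow ?T. sum f A + y \<in> G"
      proof (rule eventually_ball_finite)
        show "\<forall>A\<in>Pow ?T. \<forall>\<^sub>F y in F. sum f A + y \<in> G"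
        proof
          fix A assume "A \<in> Pow ?T"
          then show "\<forall>\<^sub>F y in F. sum f A + y \<in> G"
            using G sums[of A] G_shift by (cases "A = {}") auto
        qed
      qed simp
      moreover have "\<forall>\<^sub>F y in F. y \<notin> ?bad"
        using bad by (intro NC_F NC_compact finite_imp_compact)
      moreover have "\<forall>\<^sub>F y in F. y \<notin> cball 0 (real t)"
        by (intro NC_F NC_compact) simp
      ultimately have "\<forall>\<^sub>F y in F. \<Phi> f t y"
      proof eventually_elim
        case (elim y)
        have "\<forall>u\<in>?D f t. \<forall>v\<in>?D f t. y \<noteq> u - v"
          using elim(2) by blast
        moreover have "\<exists>s<t. \<pi> s = \<pi> t" using False by blast
        moreover have "real t < norm y" using elim(3) by simp
        ultimately show ?case
          using elim(1) unfolding \<Phi>_def by auto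
      qed
      moreover have "F \<noteq> bot"
        using notNC[of "\<lambda>_. False"] NC_compact[of "{}"] by auto
      ultimately show ?thesis using eventually_happens' by blast
    qed
  qed
  then obtain c where c: "\<And>t. \<Phi> c t (c t)" by blast

  \<comment> \<open>Let \<open>t\<close> be the largest index in the symmetric difference. After
    cancelling common terms, \<open>c t\<close> is a difference of two sums over indices below
    \<open>t\<close>, which its choice excluded.\<close>
  have sum_inj: "A = B" if "finite A" "finite B" "sum c A = sum c B" for A B
  proof (rule ccontr)
    define M where "M = (A - B) \<union> (B - A)"
    assume "A \<noteq> B"
    then have M: "finite M" "M \<noteq> {}" using that by (auto simp: M_def)
    define t where "t = Max M"
    have t: "t \<in> M" "\<And>s. s \<in> M \<Longrightarrow> s \<le> t" using M by (auto simp: t_def)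
    have diff: "sum c (A - B) = sum c (B - A)"
      using that by (simp add: sum_diff1' sum.Int_Diff[of A c B] sum.Int_Diff[of B c A] Int_commute)
    have "False" if "t \<in> A'" "A' \<subseteq> M" "B' \<subseteq> M - {t}" "sum c A' = sum c B'" for A' B'
    proof -
      have "finite A'" using that(2) M(1) finite_subset by blast
      then have "c t = sum c B' - sum c (A' - {t})"
        using that(1,4) by (simp add: sum.remove algebra_simps)
      moreover have "s < t" if "s \<in> M - {t}" for s
        using that t(2)[of s] by simp
      then have "A' - {t} \<subseteq> {..<t}" "B' \<subseteq> {..<t}"
        using that(2,3) by auto
      ultimately show False using c[of t] unfolding \<Phi>_def by blast
    qed
    from this[of "A - B" "B - A"] this[of "B - A" "A - B"] show False
      using t(1) diff by (auto simp: M_def)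
  qed

  define a where "a i j = c (prod_encode (i, j))" for i j
  have FS_eq: "FS (a i) = {sum c A | A. finite A \<and> A \<noteq> {} \<and> (\<forall>s\<in>A. \<pi> s = i)}" for i
  proof (intro equalityI subsetI)
    fix x assume "x \<in> FS (a i)"
    then obtain B where B: "finite B" "B \<noteq> {}" "x = (\<Sum>j\<in>B. a i j)" by (auto simp: FS_def)
    let ?A = "(\<lambda>j. prod_encode (i, j)) ` B"
    have "inj_on (\<lambda>j. prod_encode (i, j)) B" by (auto simp: inj_on_def)
    then have "x = sum c ?A" by (simp add: B(3) a_def sum.reindex)
    then show "x \<in> {sum c A | A. finite A \<and> A \<noteq> {} \<and> (\<forall>s\<in>A. \<pi> s = i)}"
      using B by (auto simp: \<pi>_def intro!: exI[of _ ?A])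
  next
    fix x assume "x \<in> {sum c A | A. finite A \<and> A \<noteq> {} \<and> (\<forall>s\<in>A. \<pi> s = i)}"
    then obtain A where A: "finite A" "A \<noteq> {}" "\<And>s. s \<in> A \<Longrightarrow> \<pi> s = i" "x = sum c A" by blast
    let ?g = "\<lambda>s. snd (prod_decode s)"
    have enc: "prod_encode (i, ?g s) = s" if "s \<in> A" for s
      using A(3)[OF that] by (metis \<pi>_def prod.collapse prod_decode_inverse)
    have "inj_on ?g A"
      by (rule inj_on_inverseI[of _ "\<lambda>j. prod_encode (i, j)"]) (rule enc)
    then have "(\<Sum>j\<in>?g ` A. a i j) = (\<Sum>s\<in>A. a i (?g s))"
      by (simp add: sum.reindex)
    also have "\<dots> = x"
      unfolding A(4) by (intro sum.cong) (simp_all add: a_def enc)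
    finally have "x = (\<Sum>j\<in>?g ` A. a i j)" by simp
    then show "x \<in> FS (a i)" using A(1,2) by (auto simp: FS_def intro!: exI[of _ "?g ` A"])
  qed
  have FS_G: "FS (a i) \<subseteq> G" for i
  proof
    fix x assume "x \<in> FS (a i)"
    then obtain A where A: "finite A" "A \<noteq> {}" "\<And>s. s \<in> A \<Longrightarrow> \<pi> s = i" "x = sum c A"
      by (auto simp: FS_eq)
    define s where "s = Max A"
    have s: "s \<in> A" "\<And>s'. s' \<in> A \<Longrightarrow> s' \<le> s" using A by (auto simp: s_def)
    have "sum c (A - {s}) + c s \<in> G" by (rule \<Phi>_sum[OF c below[OF s A(3)]])
    then show "x \<in> G" using A s by (simp add: sum.remove add.commute)
  qed
  have c_nonneg: "0 \<le> c s $ k" for s k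
    using \<Phi>_sum[OF c[of s], of "{}"] nonneg[of "c s" k] by (simp add: G_def)
  have inj: "inj (a i)" for i
  proof (rule injI)
    fix j k assume "a i j = a i k"
    then have "{prod_encode (i, j)} = {prod_encode (i, k)}"
      by (intro sum_inj) (auto simp: a_def)
    then show "j = k" by simp
  qed
  have disj: "FS (a i) \<inter> FS (a j) = {}" if "i \<noteq> j" for i j
  proof (rule ccontr)
    assume "FS (a i) \<inter> FS (a j) \<noteq> {}"
    then obtain x where "x \<in> FS (a i)" "x \<in> FS (a j)" by blast
    then obtain A B where A: "finite A" "A \<noteq> {}" "\<And>s. s \<in> A \<Longrightarrow> \<pi> s = i" "x = sum c A"
      and B: "finite B" "\<And>s. s \<in> B \<Longrightarrow> \<pi> s = j" "x = sum c B"
      unfolding FS_eq by blast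
    have "A = B" using A(4) B(3) by (intro sum_inj A(1) B(1)) simp
    moreover obtain s where "s \<in> A" using A(2) by blast
    ultimately show False using A(3)[of s] B(2)[of s] that by simp
  qed
  \<comment> \<open>Every term of sequence \<open>i\<close> except the one at \<open>t0\<close> has
    norm above its index, and with nonnegative coordinates a sum is at least as long as each of its
    terms. Hence a ball meets only sums over a fixed finite set of indices.\<close>
  have discr: "closed (FS (a i)) \<and> discrete (FS (a i))" for i
  proof (rule closed_discrete_if_locally_finite)
    fix x :: "real ^ 'n"
    define t0 where "t0 = (LEAST t. \<pi> t = i)"
    obtain m :: nat where m: "norm x + 1 < real m" using reals_Archimedean2 by blast
    have "\<pi> (prod_encode (i, 0)) = i" by (simp add: \<pi>_def)
    then have t0: "\<pi> t0 = i" unfolding t0_def by (rule LeastI)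
    have "FS (a i) \<inter> ball x 1 \<subseteq> sum c ` Pow (insert t0 {..<m})"
    proof
      fix y assume y: "y \<in> FS (a i) \<inter> ball x 1"
      then obtain A where A: "finite A" "\<And>s. s \<in> A \<Longrightarrow> \<pi> s = i" "y = sum c A"
        by (auto simp: FS_eq)
      have "norm y < real m"
        using y m norm_triangle_sub[of y x] by (simp add: dist_norm norm_minus_commute)
      have "s < m" if "s \<in> A" "s \<noteq> t0" for s
      proof -
        have "t0 \<le> s" unfolding t0_def using A(2)[OF that(1)] by (rule Least_le)
        then have "\<exists>s'<s. \<pi> s' = \<pi> s" using that t0 A(2) by (metis le_neq_implies_less)
        then have "real s < norm (c s)" using c[of s] by (simp add: \<Phi>_def)
        also have "\<dots> \<le> norm y"
        proof (rule norm_le_componentwise_cart)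
          fix k
          have "c s $ k \<le> (\<Sum>s\<in>A. c s $ k)"
            using A(1) that(1) c_nonneg by (intro member_le_sum) auto
          then show "norm (c s $ k) \<le> norm (y $ k)"
            using c_nonneg[of s k] by (simp add: A(3))
        qed
        finally show ?thesis using \<open>norm y < real m\<close> by simp
      qed
      then show "y \<in> sum c ` Pow (insert t0 {..<m})" using A(3) by blast
    qed
    then show "finite (FS (a i) \<inter> ball x 1)"
      by (rule finite_subset) simp
  qed
  \<comment> \<open>Otherwise the closure of the sums in \<open>Q\<close> would miss a basic set
    \<open>U i\<close>, but the first term of sequence \<open>i\<close> was put into it.\<close>
  have dense: "dense_in (\<Union>i. FS (a i)) Q"
    unfolding dense_in_def
  proof
    fix x assume "x \<in> Q"
    show "x \<in> closure ((\<Union>i. FS (a i)) \<inter> Q)"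
    proof (rule ccontr)
      let ?cl = "closure ((\<Union>i. FS (a i)) \<inter> Q)"
      assume "x \<notin> ?cl"
      then have "\<exists>V\<in>?\<B>. V \<subseteq> Q - ?cl"
        using \<open>x \<in> Q\<close> Q(1) by (intro basis) auto
      then obtain i where i: "U i \<subseteq> Q - ?cl" using U by (metis rangeE)
      define t0 where "t0 = (LEAST t. \<pi> t = i)"
      have "\<pi> (prod_encode (i, 0)) = i" by (simp add: \<pi>_def)
      then have t0: "\<pi> t0 = i" unfolding t0_def by (rule LeastI)
      have "\<not> (\<exists>s<t0. \<pi> s = \<pi> t0)"
        using not_less_Least t0 unfolding t0_def by metis
      with c[of t0] have "c t0 \<in> U (\<pi> t0)" unfolding \<Phi>_def by (simp only: if_False)
      then have "c t0 \<in> U i" by (simp only: t0)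
      moreover have "c t0 \<in> FS (a i)"
        using t0 by (auto simp: FS_eq intro!: exI[of _ "{t0}"])
      ultimately show False
        using i closure_subset[of "(\<Union>i. FS (a i)) \<inter> Q"] by blast
    qed
  qed
  have "FS (a i) \<subseteq> E" for i using FS_G[of i] by (auto simp: G_def)
  with inj discr disj Q(1,2) dense show thesis by (intro that)
qed

section \<open>From the tails modulo \<open>NC\<close> to the coloring theorem\<close>

lemma range_subset_FS: "range a \<subseteq> FS a"
proof
  fix x assume "x \<in> range a"
  then obtain k where "x = sum a {k}" by auto
  then show "x \<in> FS a" unfolding FS_def by blast
qed

theorem corollary1p10:
  fixes C :: "(real ^ 'n::finite) set"
  assumes "C \<in> NC"
  shows "\<exists>P :: (real ^ 'n) set. open P \<and> P \<notin> NC \<and> C \<subseteq> P \<and>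
    (\<forall>col. finite_coloring (pos_rat_vectors - P) col \<longrightarrow>
      (\<exists>\<A> :: (nat \<Rightarrow> real ^ 'n) set.
         infinite \<A> \<and>
         (\<forall>a\<in>\<A>. inj a \<and> range a \<subseteq> pos_rat_vectors - P) \<and>
         (\<forall>a\<in>\<A>. closed (FS a) \<and> discrete (FS a)) \<and>
         monochromatic (pos_rat_vectors - P) col (\<Union>a\<in>\<A>. FS a) \<and>
         (\<forall>a\<in>\<A>. \<forall>b\<in>\<A>. a \<noteq> b \<longrightarrow> FS a \<inter> FS b = {}) \<and>
         (\<exists>Q. open Q \<and> \<not> bounded Q \<and> dense_in (\<Union>a\<in>\<A>. FS a) Q)))"
proof -
  obtain P and S :: "nat \<Rightarrow> (real ^ 'n) set" where P: "open P" "C \<subseteq> P" "P \<notin> NC"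
    and S: "decseq S" "\<And>m. S m \<subseteq> pos_rat_vectors - P" "\<And>m. S m \<notin> NC"
    and S_add: "\<And>m x. x \<in> S m \<Longrightarrow> \<exists>l. \<forall>y\<in>S l. x + y \<in> S m"
    using NC_avoiding_additive_tails[OF assms] by metis
  \<comment> \<open>Members contain some tail \<open>S m\<close> up to a set in \<open>NC\<close>;
    in particular the complements of sets in \<open>NC\<close> are members.\<close>
  define F0 where "F0 = Abs_filter (\<lambda>P. \<exists>m. {x \<in> S m. \<not> P x} \<in> NC)"
  have ev: "eventually P F0 \<longleftrightarrow> (\<exists>m. {x \<in> S m. \<not> P x} \<in> NC)" for P
    unfolding F0_def
  proof (rule eventually_Abs_filter, rule is_filter.intro)
    show "\<exists>m. {x \<in> S m. \<not> True} \<in> NC" using NC_compact[of "{}"] by simp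
  next
    fix P Q assume "\<exists>m. {x \<in> S m. \<not> P x} \<in> NC" "\<exists>m. {x \<in> S m. \<not> Q x} \<in> NC"
    then obtain k l where "{x \<in> S k. \<not> P x} \<in> NC" "{x \<in> S l. \<not> Q x} \<in> NC" by blast
    from NC_Un[OF this] have "{x \<in> S (max k l). \<not> (P x \<and> Q x)} \<in> NC"
      by (rule NC_subset)
         (use decseqD[OF S(1), of k "max k l"] decseqD[OF S(1), of l "max k l"] in auto)
    then show "\<exists>m. {x \<in> S m. \<not> (P x \<and> Q x)} \<in> NC" ..
  next
    fix P Q assume PQ: "\<forall>x. P x \<longrightarrow> Q x" and "\<exists>m. {x \<in> S m. \<not> P x} \<in> NC"
    then obtain m where "{x \<in> S m. \<not> P x} \<in> NC" by blast
    then have "{x \<in> S m. \<not> Q x} \<in> NC" by (rule NC_subset) (use PQ in auto)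
    then show "\<exists>m. {x \<in> S m. \<not> Q x} \<in> NC" ..
  qed
  have "F0 \<noteq> bot" using S(3) by (simp add: trivial_limit_def ev)
  moreover have "filter_add F0 F0 \<le> F0"
    unfolding le_filter_def eventually_filter_add
  proof (intro allI impI)
    fix P assume "eventually P F0"
    then obtain m where m: "{x \<in> S m. \<not> P x} \<in> NC" by (auto simp: ev)
    \<comment> \<open>On a suitable tail, the exceptional \<open>y\<close> lie in a translate of the
      exceptional set of \<open>P\<close>, and \<open>NC\<close> is invariant under
      translations.\<close>
    have "\<forall>\<^sub>F y in F0. P (x + y)" if x: "x \<in> S m" for x
    proof -
      obtain l where l: "\<And>y. y \<in> S l \<Longrightarrow> x + y \<in> S m" using S_add[OF x] by blast
      have "{y \<in> S l. \<not> P (x + y)} \<in> NC"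
        by (rule NC_subset[OF NC_translation[OF m, of "- x"]])
           (auto simp: l intro!: image_eqI[of _ _ "x + _"])
      then show ?thesis by (auto simp: ev)
    qed
    then show "\<forall>\<^sub>F x in F0. \<forall>\<^sub>F y in F0. P (x + y)"
      unfolding ev[of "\<lambda>x. \<forall>\<^sub>F y in F0. P (x + y)"]
      by (intro exI[of _ m]) (use NC_compact[of "{}"] in \<open>simp cong: conj_cong\<close>)
  qed
  ultimately obtain F where F: "ultra F" "F \<le> F0" "filter_add F F \<le> F"
    by (rule subidempotent_ultra_below)
  have NC_F: "\<forall>\<^sub>F x in F. x \<notin> A" if "A \<in> NC" for A
  proof -
    have "{x \<in> S 0. \<not> x \<notin> A} \<in> NC" using that by (rule NC_subset) auto
    then have "\<forall>\<^sub>F x in F0. x \<notin> A" by (auto simp: ev)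
    with F(2) show ?thesis by (rule filter_leD)
  qed
  have notNC: "{x. P x} \<notin> NC" if "eventually P F" for P
  proof
    assume "{x. P x} \<in> NC"
    then have "\<forall>\<^sub>F x in F. \<not> P x" using NC_F by force
    with that have "\<forall>\<^sub>F x in F. False" by eventually_elim simp
    with F(1) show False by (simp add: ultra_def)
  qed
  have S0: "\<forall>\<^sub>F x in F. x \<in> S 0"
  proof (rule filter_leD[OF F(2)])
    show "\<forall>\<^sub>F x in F0. x \<in> S 0"
      unfolding ev using NC_compact[of "{}"] by (intro exI[of _ 0]) simp
  qed
  have "\<exists>\<A> :: (nat \<Rightarrow> real ^ 'n) set.
         infinite \<A> \<and>
         (\<forall>a\<in>\<A>. inj a \<and> range a \<subseteq> pos_rat_vectors - P) \<and>
         (\<forall>a\<in>\<A>. closed (FS a) \<and> discrete (FS a)) \<and>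
         monochromatic (pos_rat_vectors - P) col (\<Union>a\<in>\<A>. FS a) \<and>
         (\<forall>a\<in>\<A>. \<forall>b\<in>\<A>. a \<noteq> b \<longrightarrow> FS a \<inter> FS b = {}) \<and>
         (\<exists>Q. open Q \<and> \<not> bounded Q \<and> dense_in (\<Union>a\<in>\<A>. FS a) Q)"
    if col: "finite_coloring (pos_rat_vectors - P) col" for col
  proof -
    have "\<forall>\<^sub>F x in F. col x \<in> col ` (pos_rat_vectors - P)"
      using S0 by (rule eventually_mono) (use S(2) in blast)
    then obtain k where k: "\<forall>\<^sub>F x in F. col x = k"
      using ultra_finite_range[OF F(1)] col by (metis finite_coloring_def)
    define E where "E = {x \<in> S 0. col x = k}"
    have E: "\<forall>\<^sub>F x in F. x \<in> E"
      using S0 k by eventually_elim (simp add: E_def)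
    have E_sub: "E \<subseteq> pos_rat_vectors - P" using S(2) by (auto simp: E_def)
    then have "0 \<le> x $ i" if "x \<in> E" for x i
      using that by (auto simp: pos_rat_vectors_def less_imp_le)
    from dense_family_of_FS[OF F(3) notNC E this NC_F]
    obtain a :: "nat \<Rightarrow> nat \<Rightarrow> real ^ 'n" and Q where
      a: "\<And>i. inj (a i)" "\<And>i. FS (a i) \<subseteq> E" "\<And>i. closed (FS (a i)) \<and> discrete (FS (a i))"
        "\<And>i j. i \<noteq> j \<Longrightarrow> FS (a i) \<inter> FS (a j) = {}"
      and Q: "open Q" "\<not> bounded Q" "dense_in (\<Union>i. FS (a i)) Q"
      by metis
    \<comment> \<open>The sets \<open>FS (a i)\<close> are nonempty and pairwise disjoint, so the
      sequences are distinct and the family is infinite.\<close>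
    have "inj a"
    proof (rule injI)
      fix i j assume "a i = a j"
      then have "FS (a i) \<inter> FS (a j) \<noteq> {}" using range_subset_FS[of "a i"] by auto
      then show "i = j" using a(4) by blast
    qed
    then have "infinite (range a)" by (simp add: finite_image_iff)
    moreover have "monochromatic (pos_rat_vectors - P) col (\<Union>b\<in>range a. FS b)"
      unfolding monochromatic_def using a(2) E_sub by (auto simp: E_def) blast
    moreover have "range (a i) \<subseteq> pos_rat_vectors - P" for i
      using range_subset_FS[of "a i"] a(2)[of i] E_sub by blast
    moreover have "FS (a i) \<inter> FS (a j) = {}" if "a i \<noteq> a j" for i j
      using a(4) that by metis
    ultimately show ?thesis
      using a Q by (intro exI[of _ "range a"]) (simp add: image_image; blast)
  qed
  with P show ?thesis by blast
qed

end
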